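(* Let $r\in(0,1)$. The union $\bigcup_{t\in[-1,1]}D_\rho(t,r)$ of pseudohyperbolic disks has boundary $\mathcal{A}_1\cup\mathcal{A}_2$, where $$\mathcal{A}_1=\left\{z\in\mathbb{C}:\left|z+\tfrac{1-r^2}{2r}i\right|=\tfrac{1+r^2}{2r},\ \Im(z)\ge 0\right\},\qquad \mathcal{A}_2=\left\{z\in\mathbb{C}:\left|z-\tfrac{1-r^2}{2r}i\right|=\tfrac{1+r^2}{2r},\ \Im(z)\le 0\right\}.$$
   Context: For $\beta$ in the open unit disk $\mathbb{D}$ and $r\in(0,1)$, the pseudohyperbolic disk is $D_\rho(\beta,r)=\left\{z\in\mathbb{C}:\left|\frac{z-\beta}{1-\bar\beta z}\right|<r\right\}$; it is the open Euclidean disk with center $\frac{(1-r^2)\beta}{1-r^2|\beta|^2}$ and radius $\frac{r(1-|\beta|^2)}{1-r^2|\beta|^2}$. For $|\beta|=1$ the same Euclidean formulas are used, giving center $\beta$ and radius $0$, so $D_\rho(\pm1,r)$ is the empty set. Boundary means topological boundary in $\mathbb{C}$. *)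

theory Defs
  imports "HOL-Analysis.Analysis"
begin

definition euclidean_center :: "complex \<Rightarrow> real \<Rightarrow> complex" where
  "euclidean_center \<beta> r = of_real (1 - r\<^sup>2) * \<beta> / of_real (1 - r\<^sup>2 * (cmod \<beta>)\<^sup>2)"

definition euclidean_radius :: "complex \<Rightarrow> real \<Rightarrow> real" where
  "euclidean_radius \<beta> r = r * (1 - (cmod \<beta>)\<^sup>2) / (1 - r\<^sup>2 * (cmod \<beta>)\<^sup>2)"

(* The condition 1 - cnj \<beta> * z \<noteq> 0 excludes the pole z = 1 / cnj \<beta>, where the convention
   x / 0 = 0 would otherwise make the quotient 0 and put the pole into the disk.
   The second case is meant for cmod \<beta> = 1, where the radius is 0 and the disk is empty;
   values of \<beta> outside the closed unit disk are not used. *)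
definition pseudohyperbolic_disk :: "complex \<Rightarrow> real \<Rightarrow> complex set" where
  "pseudohyperbolic_disk \<beta> r =
     (if cmod \<beta> < 1
      then {z. 1 - cnj \<beta> * z \<noteq> 0 \<and> cmod ((z - \<beta>) / (1 - cnj \<beta> * z)) < r}
      else ball (euclidean_center \<beta> r) (euclidean_radius \<beta> r))"

definition upper_arc :: "real \<Rightarrow> complex set" where
  "upper_arc r =
     {z. cmod (z + of_real ((1 - r\<^sup>2) / (2 * r)) * \<i>) = (1 + r\<^sup>2) / (2 * r) \<and> Im z \<ge> 0}"

definition lower_arc :: "real \<Rightarrow> complex set" where
  "lower_arc r =
     {z. cmod (z - of_real ((1 - r\<^sup>2) / (2 * r)) * \<i>) = (1 + r\<^sup>2) / (2 * r) \<and> Im z \<le> 0}"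

end

(* For -1 < t < 1 the condition z \<in> D(t, r) says that a quadratic polynomial in t is negative.
   Its discriminant is, up to a positive factor, r^2 (1 - |z|^2)^2 - (1 - r^2)^2 (Im z)^2,
   and for |z| < 1 its minimum is attained inside (-1, 1).  Hence the union is the sublevel set
   |z|^2 + (1 - r^2) / r * |Im z| < 1, which is open and star-shaped about 0, so its boundary is
   the corresponding level set: the two arcs. *)
theory Submission
  imports Defs
begin

text \<open>Clearing the denominator and squaring turns the disk condition into |z - t|^2 < r^2 |1 -
  t z|^2, which is quadratic in \<open>t\<close>.\<close>

lemma disk_quadratic:
  fixes r t :: real and z :: complex
  assumes r: "0 < r" "r < 1" and t: "\<bar>t\<bar> < 1"
  shows "z \<in> pseudohyperbolic_disk (complex_of_real t) r \<longleftrightarrow>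
    t\<^sup>2 * (1 - r\<^sup>2 * (cmod z)\<^sup>2) - 2 * t * Re z * (1 - r\<^sup>2) + ((cmod z)\<^sup>2 - r\<^sup>2) < 0"
    (is "_ \<longleftrightarrow> ?q < 0")
proof -
  let ?w = "1 - complex_of_real t * z"
  have q: "?q = (cmod (z - complex_of_real t))\<^sup>2 - r\<^sup>2 * (cmod ?w)\<^sup>2"
    by (simp add: cmod_power2) algebra
  have "z \<in> pseudohyperbolic_disk (complex_of_real t) r \<longleftrightarrow>
      ?w \<noteq> 0 \<and> cmod (z - complex_of_real t) < r * cmod ?w"
    using t by (auto simp: pseudohyperbolic_disk_def norm_divide field_simps)
  \<comment> \<open>At the pole \<open>?w = 0\<close> the right-hand side is 0, so the strict
    inequality already excludes it.\<close>
  also have "\<dots> \<longleftrightarrow> cmod (z - complex_of_real t) < r * cmod ?w"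
    by auto
  also have "\<dots> \<longleftrightarrow> (cmod (z - complex_of_real t))\<^sup>2 < (r * cmod ?w)\<^sup>2"
    using r by (auto intro: power_strict_mono power2_less_imp_less)
  finally show ?thesis
    by (simp add: q power_mult_distrib)
qed

text \<open>By |1 - t z|^2 = |z - t|^2 + (1 - t^2)(1 - |z|^2), the quadratic splits into two terms
  that are both nonnegative once |z| \<ge> 1.\<close>

lemma cmod_less_1_of_disk_quadratic:
  fixes r t :: real and z :: complex
  assumes r: "0 < r" "r < 1" and t: "\<bar>t\<bar> < 1"
    and q: "t\<^sup>2 * (1 - r\<^sup>2 * (cmod z)\<^sup>2) - 2 * t * Re z * (1 - r\<^sup>2) + ((cmod z)\<^sup>2 - r\<^sup>2) < 0"
  shows "(cmod z)\<^sup>2 < 1"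
proof (rule ccontr)
  assume "\<not> (cmod z)\<^sup>2 < 1"
  then have S: "(cmod z)\<^sup>2 \<ge> 1" by simp
  have t2: "t\<^sup>2 < 1" using t by (simp add: abs_square_less_1)
  have r2: "r\<^sup>2 < 1" using r by (simp add: power_less_one_iff)
  have "t\<^sup>2 * (1 - r\<^sup>2 * (cmod z)\<^sup>2) - 2 * t * Re z * (1 - r\<^sup>2) + ((cmod z)\<^sup>2 - r\<^sup>2)
      = (1 - r\<^sup>2) * ((Re z - t)\<^sup>2 + (Im z)\<^sup>2) + r\<^sup>2 * ((1 - t\<^sup>2) * ((cmod z)\<^sup>2 - 1))"
    by (simp add: cmod_power2) algebra
  moreover have "\<dots> \<ge> 0"
    using S t2 r2 by (intro add_nonneg_nonneg mult_nonneg_nonneg) auto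
  ultimately show False using q by linarith
qed

text \<open>Completing the square in \<open>t\<close>; the subtracted term is a quarter of the
  discriminant.\<close>

lemma discriminant_identity:
  fixes r :: real and z :: complex
  shows "(1 - r\<^sup>2 * (cmod z)\<^sup>2) *
      (t\<^sup>2 * (1 - r\<^sup>2 * (cmod z)\<^sup>2) - 2 * t * Re z * (1 - r\<^sup>2) + ((cmod z)\<^sup>2 - r\<^sup>2))
    = (t * (1 - r\<^sup>2 * (cmod z)\<^sup>2) - Re z * (1 - r\<^sup>2))\<^sup>2
      - ((r * (1 - (cmod z)\<^sup>2))\<^sup>2 - ((1 - r\<^sup>2) * Im z)\<^sup>2)"
  unfolding cmod_power2 by algebra

lemma Union_disks_eq:
  fixes r :: real
  assumes r: "0 < r" "r < 1"
  shows "(\<Union>t\<in>{-1..1::real}. pseudohyperbolic_disk (complex_of_real t) r)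
    = {z. (cmod z)\<^sup>2 + (1 - r\<^sup>2) / r * \<bar>Im z\<bar> < 1}"
proof (intro set_eqI iffI)
  have r2: "0 < 1 - r\<^sup>2" using r by (simp add: power_less_one_iff)
  have less_iff: "(cmod z)\<^sup>2 + (1 - r\<^sup>2) / r * \<bar>Im z\<bar> < 1 \<longleftrightarrow>
      \<bar>(1 - r\<^sup>2) * Im z\<bar> < r * (1 - (cmod z)\<^sup>2)" for z
  proof -
    have abs: "\<bar>(1 - r\<^sup>2) * Im z\<bar> = (1 - r\<^sup>2) * \<bar>Im z\<bar>"
      using r2 by (simp add: abs_mult)
    show ?thesis
      unfolding abs using r by (simp add: field_simps)
  qed
  \<comment> \<open>The leading coefficient is positive, so multiplying by it keeps the sign of the
    quadratic.\<close>
  have pos: "1 - r\<^sup>2 * (cmod z)\<^sup>2 > 0" if "(cmod z)\<^sup>2 < 1" for z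
    using mult_strict_mono[of "r\<^sup>2" 1 "(cmod z)\<^sup>2" 1] r2 that by simp
  {
    fix z assume "z \<in> (\<Union>t\<in>{-1..1::real}. pseudohyperbolic_disk (complex_of_real t) r)"
    then obtain t where t: "\<bar>t\<bar> \<le> 1" and z: "z \<in> pseudohyperbolic_disk (complex_of_real t) r"
      by (auto simp: abs_le_iff)
    \<comment> \<open>At the endpoints the Euclidean radius is 0 and the ball is empty.\<close>
    have t1: "\<bar>t\<bar> < 1"
    proof (rule ccontr)
      assume "\<not> \<bar>t\<bar> < 1"
      with t have "\<bar>t\<bar> = 1" by simp
      then show False
        using z by (simp add: pseudohyperbolic_disk_def euclidean_radius_def)
    qed
    note q = z[unfolded disk_quadratic[OF r t1]]
    have S: "(cmod z)\<^sup>2 < 1" by (rule cmod_less_1_of_disk_quadratic[OF r t1 q])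
    have "((1 - r\<^sup>2) * Im z)\<^sup>2 < (r * (1 - (cmod z)\<^sup>2))\<^sup>2"
      using mult_pos_neg[OF pos[OF S] q]
        zero_le_power2[of "t * (1 - r\<^sup>2 * (cmod z)\<^sup>2) - Re z * (1 - r\<^sup>2)"]
      unfolding discriminant_identity by linarith
    then have "\<bar>(1 - r\<^sup>2) * Im z\<bar> < \<bar>r * (1 - (cmod z)\<^sup>2)\<bar>"
      by - (rule power2_less_imp_less, simp_all only: power2_abs abs_ge_zero)
    \<comment> \<open>Squaring loses the sign of 1 - |z|^2; \<open>S\<close> restores it and removes
      the absolute value on the right.\<close>
    then show "z \<in> {z. (cmod z)\<^sup>2 + (1 - r\<^sup>2) / r * \<bar>Im z\<bar> < 1}"
      using S r unfolding mem_Collect_eq less_iff by simp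
  next
    fix z assume "z \<in> {z. (cmod z)\<^sup>2 + (1 - r\<^sup>2) / r * \<bar>Im z\<bar> < 1}"
    then have Im: "\<bar>(1 - r\<^sup>2) * Im z\<bar> < r * (1 - (cmod z)\<^sup>2)"
      unfolding mem_Collect_eq less_iff .
    then have "0 < r * (1 - (cmod z)\<^sup>2)" by linarith
    then have S: "(cmod z)\<^sup>2 < 1" using r by (simp add: zero_less_mult_iff)
    then have m: "cmod z < 1" by (simp add: power2_less_1_iff abs_square_less_1)
    \<comment> \<open>The vertex of the parabola, where the completed square vanishes.\<close>
    define t where "t = Re z * (1 - r\<^sup>2) / (1 - r\<^sup>2 * (cmod z)\<^sup>2)"
    have "\<bar>Re z\<bar> * (1 - r\<^sup>2) \<le> cmod z * (1 - r\<^sup>2)"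
      using r2 by (intro mult_right_mono abs_Re_le_cmod) auto
    \<comment> \<open>This product equals 1 - r^2 |z|^2 - (1 - r^2) |z|; its positivity puts the
      vertex inside (-1, 1).\<close>
    moreover have "0 < (1 - cmod z) * (1 + r\<^sup>2 * cmod z)"
      using m by (intro mult_pos_pos add_pos_nonneg) auto
    ultimately have "\<bar>Re z\<bar> * (1 - r\<^sup>2) < 1 - r\<^sup>2 * (cmod z)\<^sup>2"
      by (simp add: algebra_simps power2_eq_square)
    then have t: "\<bar>t\<bar> < 1"
      using pos[OF S] r2 by (simp add: t_def abs_mult)
    have "t * (1 - r\<^sup>2 * (cmod z)\<^sup>2) - Re z * (1 - r\<^sup>2) = 0"
      using pos[OF S] by (simp add: t_def)
    moreover have "((1 - r\<^sup>2) * Im z)\<^sup>2 < (r * (1 - (cmod z)\<^sup>2))\<^sup>2"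
      using power_strict_mono[OF Im, of 2] by simp
    ultimately have "(1 - r\<^sup>2 * (cmod z)\<^sup>2) *
        (t\<^sup>2 * (1 - r\<^sup>2 * (cmod z)\<^sup>2) - 2 * t * Re z * (1 - r\<^sup>2) + ((cmod z)\<^sup>2 - r\<^sup>2)) < 0"
      unfolding discriminant_identity by simp
    then have "z \<in> pseudohyperbolic_disk (complex_of_real t) r"
      using pos[OF S] by (simp add: disk_quadratic[OF r t] mult_less_0_iff)
    then show "z \<in> (\<Union>t\<in>{-1..1::real}. pseudohyperbolic_disk (complex_of_real t) r)"
      using t by (intro UN_I[of t]) (auto simp: abs_less_iff)
  }
qed

text \<open>Squaring the circle equations cancels k^2 and leaves |z|^2 + 2 k Im z = 1 and |z|^2 - 2
  k Im z = 1; the half-plane conditions merge them through \<open>\<bar>Im z\<bar>\<close>.\<close>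

lemma arcs_eq:
  fixes r :: real
  assumes r: "0 < r"
  shows "upper_arc r \<union> lower_arc r = {z. (cmod z)\<^sup>2 + (1 - r\<^sup>2) / r * \<bar>Im z\<bar> = 1}"
proof -
  define k where "k = (1 - r\<^sup>2) / (2 * r)"
  \<comment> \<open>Equivalently, both circles pass through 1 and -1.\<close>
  have radius: "((1 + r\<^sup>2) / (2 * r))\<^sup>2 = 1 + k\<^sup>2"
    using r by (simp add: k_def field_simps power2_eq_square)
  have circle: "cmod w = (1 + r\<^sup>2) / (2 * r) \<longleftrightarrow> (cmod w)\<^sup>2 = 1 + k\<^sup>2" for w
    unfolding radius[symmetric] using r
    by (intro power2_eq_iff_nonneg[symmetric]) (auto intro: add_nonneg_nonneg)
  have half: "(1 - r\<^sup>2) / r = 2 * k"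
    using r by (simp add: k_def field_simps)
  show ?thesis
    unfolding upper_arc_def lower_arc_def circle half k_def[symmetric]
    by (auto simp: cmod_power2 power2_sum power2_diff abs_if algebra_simps)
qed

lemma frontier_sublevel_set:
  fixes c :: real
  assumes c: "0 \<le> c"
  shows "frontier {z. (cmod z)\<^sup>2 + c * \<bar>Im z\<bar> < 1} = {z. (cmod z)\<^sup>2 + c * \<bar>Im z\<bar> = 1}"
    (is "frontier ?U = ?L")
proof -
  have op: "open ?U"
    by (intro open_Collect_less continuous_intros)
  have "closure ?U = {z. (cmod z)\<^sup>2 + c * \<bar>Im z\<bar> \<le> 1}" (is "_ = ?C")
  proof
    show "closure ?U \<subseteq> ?C"
      by (intro closure_minimal closed_Collect_le continuous_intros) auto
  next
    show "?C \<subseteq> closure ?U"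
    proof
      fix z assume z: "z \<in> ?C"
      have "of_real s * z \<in> ?U" if s: "s \<in> {0..<1}" for s :: real
      proof -
        \<comment> \<open>Scaling by \<open>s\<close> multiplies one term by s^2 and the other by
          \<open>s\<close>, so the sum shrinks at least by the factor \<open>s\<close>.\<close>
        have "s\<^sup>2 \<le> s" using s by (simp add: power2_eq_square mult_left_le)
        then have "(cmod (of_real s * z))\<^sup>2 + c * \<bar>Im (of_real s * z)\<bar>
            \<le> s * ((cmod z)\<^sup>2 + c * \<bar>Im z\<bar>)"
          using s by (simp add: norm_mult power_mult_distrib abs_mult distrib_left mult_right_mono)
        also have "\<dots> \<le> s"
          using z s by (simp add: mult_left_le)
        finally show ?thesis using s by simp
      qed
      \<comment> \<open>Continuity in \<open>s\<close> carries the inclusion to the limit s = 1,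
        which is \<open>z\<close> itself.\<close>
      then have "(\<lambda>s. of_real s * z) ` closure {0..<1::real} \<subseteq> closure ?U"
        by (intro image_closure_subset continuous_intros)
          (use closure_subset in blast)+
      then have "of_real 1 * z \<in> closure ?U"
        by (rule subsetD) (rule imageI, simp)
      then show "z \<in> closure ?U" by simp
    qed
  qed
  then show ?thesis
    by (auto simp: frontier_def interior_open[OF op])
qed

theorem theorem5p1:
  fixes r :: real
  assumes "0 < r" and "r < 1"
  shows "frontier (\<Union>t\<in>{-1..1::real}. pseudohyperbolic_disk (complex_of_real t) r)
           = upper_arc r \<union> lower_arc r"
proof -
  have "0 \<le> (1 - r\<^sup>2) / r"
    using assms by (simp add: power_le_one)
  then show ?thesis
    unfolding Union_disks_eq[OF assms] arcs_eq[OF assms(1)]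
    by (rule frontier_sublevel_set)
qed

end
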